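(* Let $\mathcal{G}$ be a strongly connected and weight-balanced weighted digraph on $N$ nodes with Laplacian $L=[L_{ij}]$. Assume there exists $\alpha>0$ such that, for all $i\in\{1,\dots,N\}$, one of the following conditions is satisfied: (a) $\dot u^i(t)+\alpha u^i(t)$ converges to a common function $l(t)$ as $t\to\infty$; (b) $\ddot u^i(t)+\alpha\dot u^i(t)$ converges to a common function $l(t)$ as $t\to\infty$. Then the algorithm $$\dot x^i=\dot u^i-\alpha(x^i-u^i)-\beta\sum_{j=1}^N L_{ij}x^j-v^i,\qquad \dot v^i=\alpha\beta\sum_{j=1}^N L_{ij}x^j,\qquad i\in\{1,\dots,N\},$$ over $\mathcal{G}$ with the given $\alpha$, and $x^i(0),v^i(0)\in\mathbb{R}$ such that $\sum_{i=1}^N v^i(0)=0$, for any $\beta>0$, makes $x^i(t)\to\frac1N\sum_{j=1}^N u^j(t)$ as $t\to\infty$, for all $i\in\{1,\dots,N\}$.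
   Context: Weighted digraph $\mathcal{G}$ on nodes (agents) $\{1,\dots,N\}$: adjacency matrix $\mathsf{A}=[a_{ij}]$ with $a_{ij}>0$ if $(i,j)$ is an edge and $a_{ij}=0$ otherwise. Weight-balanced: $\sum_j a_{ij}=\sum_j a_{ji}$ for every $i$. Laplacian: $L=D^{\rm out}-\mathsf{A}$, where $D^{\rm out}$ is diagonal with entries $\sum_j a_{ij}$. Agent $i$ has a time-varying input signal $u^i:[0,\infty)\to\mathbb{R}$, and $x^i,v^i\in\mathbb{R}$ are the variables of agent $i$. For time-varying quantities, "$f(t)$ converges to $g(t)$" and "$f(t)\to g(t)$ as $t\to\infty$" mean $f(t)-g(t)\to0$. *)

theory Defs
  imports "HOL-Analysis.Analysis" "Graph_Theory.Pair_Digraph" "Graph_Theory.Digraph_Component"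
begin

text \<open>
  The agents are the elements of a finite type, so the number of agents is
  \<open>CARD('n)\<close>.  Self-loops are permitted; they do not affect the Laplacian.
\<close>

definition digraph_of :: "'n rel \<Rightarrow> ('n, 'n \<times> 'n) pre_digraph" where
  "digraph_of E = with_proj \<lparr>pverts = UNIV, parcs = E\<rparr>"

definition weighted_digraph :: "'n rel \<Rightarrow> real ^ 'n ^ 'n \<Rightarrow> bool" where
  "weighted_digraph E A \<longleftrightarrow>
     (\<forall>i j. ((i, j) \<in> E \<longrightarrow> A $ i $ j > 0) \<and> ((i, j) \<notin> E \<longrightarrow> A $ i $ j = 0))"

definition weight_balanced :: "real ^ 'n ^ 'n \<Rightarrow> bool" where
  "weight_balanced A \<longleftrightarrow> (\<forall>i. (\<Sum>j\<in>UNIV. A $ i $ j) = (\<Sum>j\<in>UNIV. A $ j $ i))"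

definition out_degree_matrix :: "real ^ 'n ^ 'n \<Rightarrow> real ^ 'n ^ 'n" where
  "out_degree_matrix A = (\<chi> i j. if i = j then \<Sum>k\<in>UNIV. A $ i $ k else 0)"

definition laplacian :: "real ^ 'n ^ 'n \<Rightarrow> real ^ 'n ^ 'n" where
  "laplacian A = out_degree_matrix A - A"

text \<open>
  Signals live on \<open>[0,\<infinity>)\<close>.  They are represented by total functions of which only
  the values at nonnegative times matter; the derivative at \<open>0\<close> is one-sided.
\<close>

definition has_time_derivative :: "(real \<Rightarrow> real) \<Rightarrow> (real \<Rightarrow> real) \<Rightarrow> bool" where
  "has_time_derivative f f' \<longleftrightarrow>
     (\<forall>t\<ge>0. (f has_real_derivative f' t) (at t within {0..}))"

text \<open>Convergence to a time-varying target; neither signal need have a limit.\<close>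

definition converges_to :: "(real \<Rightarrow> real) \<Rightarrow> (real \<Rightarrow> real) \<Rightarrow> bool" where
  "converges_to f g \<longleftrightarrow> ((\<lambda>t. f t - g t) \<longlongrightarrow> 0) at_top"

end

theory Submission
  imports Defs
begin

text \<open>
  The quantity \<open>r i = v i + \<alpha> * (x i - u i)\<close> decouples the algorithm.  In its derivative the
  inputs and the Laplacian terms cancel, which leaves \<open>r i' = - \<alpha> * r i\<close>, so \<open>r i\<close> tends to zero
  exponentially; and eliminating \<open>v\<close> turns the first equation into
  \<open>x i' = u i' - \<beta> * (L x) i - r i\<close>.

  Weight balance makes the columns of \<open>L\<close> sum to zero, so \<open>\<Sum>i. v i\<close> stays at its initial value zero
  and the average of \<open>x - u\<close> is the average of \<open>r\<close> divided by \<open>\<alpha>\<close>: it tends to zero.  It remains to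
  show that the agents agree in the limit, that is, that the deviations of the \<open>x i\<close> from
  their average tend to zero.

  The deviations \<open>w i\<close> of the inputs from their average satisfy \<open>w i' + \<alpha> * w i \<longlongrightarrow> 0\<close> under
  the first hypothesis on the inputs, hence \<open>w i \<longlongrightarrow> 0\<close> and therefore \<open>w i' \<longlongrightarrow> 0\<close>.  The
  second hypothesis is the first one for \<open>u'\<close> in place of \<open>u\<close> and gives \<open>w i' \<longlongrightarrow> 0\<close> at once, while
  \<open>w i\<close> itself may be unbounded, like a logarithm.  In both cases only \<open>w'\<close>
  enters: the vector \<open>y\<close> of deviations of the \<open>x i\<close> from their average has sum zero and obeys
  \<open>y' = - \<beta> * L y + g\<close>, where \<open>g\<close> consists of \<open>w'\<close> and the deviations of \<open>r\<close> and tends to zero.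

  Such a \<open>y\<close> tends to zero (\<open>laplacian_flow_tendsto_zero\<close>): on zero-sum vectors the quadratic form
  of \<open>L\<close> is at least a positive multiple of the squared norm (\<open>laplacian_spectral_gap\<close>), so the squared
  norm of \<open>y\<close> decays exponentially up to a vanishing error.
\<close>

section \<open>Decay of dissipative trajectories\<close>

lemma has_time_derivative_at:
  assumes "has_time_derivative f f'" "t > 0"
  shows "(f has_real_derivative f' t) (at t)"
proof -
  have "at t within {0..} = at t"
    using assms(2) by (intro at_within_interior) auto
  then show ?thesis
    using assms unfolding has_time_derivative_def by (metis less_imp_le)
qed

text \<open>
  Once \<open>g\<close> stays below \<open>a * (e / 2)\<close>, the function \<open>(V - e / 2) * exp (a * t)\<close> no longer increases,
  so that \<open>V\<close> exceeds \<open>e / 2\<close> by at most an exponentially small amount.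
\<close>

lemma gronwall_tendsto_zero:
  fixes V V' g :: "real \<Rightarrow> real"
  assumes deriv: "has_time_derivative V V'"
    and "a > 0"
    and nonneg: "\<And>t. V t \<ge> 0"
    and ineq: "\<And>t. t \<ge> 0 \<Longrightarrow> V' t \<le> - a * V t + g t"
    and lim: "(g \<longlongrightarrow> 0) at_top"
  shows "(V \<longlongrightarrow> 0) at_top"
proof (rule tendstoI)
  fix e :: real assume "e > 0"
  have "eventually (\<lambda>t. g t < a * (e / 2)) at_top"
    using order_tendstoD(2)[OF lim, of "a * (e / 2)"] \<open>a > 0\<close> \<open>e > 0\<close> by simp
  then obtain S where S: "\<And>t. t \<ge> S \<Longrightarrow> g t < a * (e / 2)"
    by (auto simp: eventually_at_top_linorder)
  \<comment> \<open>Positive times only, where the one-sided derivatives are two-sided.\<close>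
  define T where "T = max S 1"
  define h where "h t = (V t - e / 2) * exp (a * t)" for t
  have mono: "h t \<le> h T" if "t \<ge> T" for t
  proof (rule DERIV_nonpos_imp_nonincreasing[OF that])
    fix s assume s: "T \<le> s" "s \<le> t"
    then have "s > 0" by (auto simp: T_def)
    have "(h has_real_derivative (V' s + a * (V s - e / 2)) * exp (a * s)) (at s)"
      unfolding h_def
      by (auto intro!: derivative_eq_intros has_time_derivative_at[OF deriv \<open>s > 0\<close>]
          simp: algebra_simps)
    moreover have "V' s + a * (V s - e / 2) \<le> 0"
      using ineq[of s] S[of s] s \<open>s > 0\<close> by (auto simp: T_def algebra_simps)
    then have "(V' s + a * (V s - e / 2)) * exp (a * s) \<le> 0"
      by (intro mult_nonpos_nonneg) auto
    ultimately show "\<exists>d. (h has_real_derivative d) (at s) \<and> d \<le> 0" by blast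
  qed
  have "((\<lambda>t. exp (- (a * t))) \<longlongrightarrow> 0) at_top"
    using \<open>a > 0\<close>
    by (intro filterlim_compose[OF exp_at_bot] filterlim_compose[OF filterlim_uminus_at_bot_at_top]
        filterlim_tendsto_pos_mult_at_top[OF tendsto_const]) (auto simp: filterlim_ident)
  then have "((\<lambda>t. h T * exp (- (a * t))) \<longlongrightarrow> 0) at_top"
    by (rule tendsto_mult_right_zero)
  then have "eventually (\<lambda>t. h T * exp (- (a * t)) < e / 2) at_top"
    using \<open>e > 0\<close> by (intro order_tendstoD(2)) auto
  then show "eventually (\<lambda>t. dist (V t) 0 < e) at_top"
    using eventually_ge_at_top[of T]
  proof eventually_elim
    case (elim t)
    have "V t - e / 2 = h t * exp (- (a * t))"
      by (simp add: h_def exp_minus)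
    also have "\<dots> \<le> h T * exp (- (a * t))"
      using mono[OF elim(2)] by (intro mult_right_mono) auto
    finally show ?case using elim(1) nonneg[of t] by simp
  qed
qed

text \<open>
  The squared norm of \<open>y\<close> is a Lyapunov function: Young's inequality spends half of the
  dissipation on the cross terms \<open>y i t * g i t\<close>, and the other half gives exponential decay up to
  the error \<open>\<Sum>i. (g i t)\<^sup>2 / c\<close>.
\<close>

lemma dissipative_tendsto_zero:
  fixes y y' g :: "'n::finite \<Rightarrow> real \<Rightarrow> real"
  assumes deriv: "\<And>i. has_time_derivative (y i) (y' i)"
    and "c > 0"
    and diss: "\<And>t. t \<ge> 0 \<Longrightarrow>
      (\<Sum>i\<in>UNIV. y i t * y' i t) \<le> - c * (\<Sum>i\<in>UNIV. (y i t)\<^sup>2) + (\<Sum>i\<in>UNIV. y i t * g i t)"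
    and lim: "\<And>i. (g i \<longlongrightarrow> 0) at_top"
  shows "(y i \<longlongrightarrow> 0) at_top"
proof -
  define V where "V t = (\<Sum>i\<in>UNIV. (y i t)\<^sup>2)" for t
  have "(V \<longlongrightarrow> 0) at_top"
  proof (rule gronwall_tendsto_zero)
    show "has_time_derivative V (\<lambda>t. 2 * (\<Sum>i\<in>UNIV. y i t * y' i t))"
      using deriv unfolding has_time_derivative_def V_def
      by (auto intro!: derivative_eq_intros simp: sum_distrib_left mult_ac)
    show "V t \<ge> 0" for t unfolding V_def by (intro sum_nonneg) auto
    have young: "2 * (p * q) \<le> c * p\<^sup>2 + q\<^sup>2 / c" for p q :: real
    proof -
      have "0 \<le> (c * p - q)\<^sup>2 / c" using \<open>c > 0\<close> by simp
      also have "\<dots> = c * p\<^sup>2 + q\<^sup>2 / c - 2 * (p * q)"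
        using \<open>c > 0\<close> by (simp add: field_simps power2_eq_square)
      finally show ?thesis by simp
    qed
    show "2 * (\<Sum>i\<in>UNIV. y i t * y' i t) \<le> - c * V t + (\<Sum>i\<in>UNIV. (g i t)\<^sup>2 / c)"
      if "t \<ge> 0" for t
    proof -
      have "2 * (\<Sum>i\<in>UNIV. y i t * g i t) \<le> (\<Sum>i\<in>UNIV. c * (y i t)\<^sup>2 + (g i t)\<^sup>2 / c)"
        unfolding sum_distrib_left by (intro sum_mono young)
      also have "\<dots> = c * V t + (\<Sum>i\<in>UNIV. (g i t)\<^sup>2 / c)"
        by (simp add: V_def sum.distrib sum_distrib_left)
      finally show ?thesis using diss[OF that] by (simp add: V_def)
    qed
    show "((\<lambda>t. \<Sum>i\<in>UNIV. (g i t)\<^sup>2 / c) \<longlongrightarrow> 0) at_top"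
      using \<open>c > 0\<close> by (auto intro!: tendsto_eq_intros lim)
  qed (use \<open>c > 0\<close> in auto)
  then have "((\<lambda>t. (y i t)\<^sup>2) \<longlongrightarrow> 0) at_top"
  proof (rule Lim_null_comparison[rotated], intro always_eventually allI)
    show "norm ((y i t)\<^sup>2) \<le> V t" for t
      unfolding V_def using member_le_sum[of i UNIV "\<lambda>i. (y i t)\<^sup>2"] by simp
  qed
  then show ?thesis by simp
qed

lemma scalar_decay:
  assumes "has_time_derivative f f'" "a > 0"
    and lim: "((\<lambda>t. f' t + a * f t) \<longlongrightarrow> 0) at_top"
  shows "(f \<longlongrightarrow> 0) at_top"
  using dissipative_tendsto_zero[of "\<lambda>_::unit. f" "\<lambda>_. f'" a "\<lambda>_ t. f' t + a * f t"] assms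
  by (simp add: algebra_simps power2_eq_square)

section \<open>The Laplacian of a weight-balanced digraph\<close>

lemma laplacian_nth:
  "laplacian A $ i $ j = (if i = j then \<Sum>k\<in>UNIV. A $ i $ k else 0) - A $ i $ j"
  by (simp add: laplacian_def out_degree_matrix_def)

lemma laplacian_sum_mult:
  "(\<Sum>j\<in>UNIV. laplacian A $ i $ j * f j) = (\<Sum>j\<in>UNIV. A $ i $ j * (f i - f j))"
proof -
  have "(\<Sum>j\<in>UNIV. laplacian A $ i $ j * f j)
    = (\<Sum>j\<in>UNIV. if i = j then (\<Sum>k\<in>UNIV. A $ i $ k) * f j else 0) - (\<Sum>j\<in>UNIV. A $ i $ j * f j)"
    unfolding sum_subtractf[symmetric] by (intro sum.cong) (auto simp: laplacian_nth algebra_simps)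
  then show ?thesis
    by (simp add: right_diff_distrib sum_subtractf sum_distrib_right)
qed

text \<open>
  Both sides weight \<open>f\<close> by degrees of the vertices, out-degrees on the left and in-degrees on the right.
\<close>

lemma weight_balanced_sum_swap:
  assumes "weight_balanced A"
  shows "(\<Sum>i\<in>UNIV. \<Sum>j\<in>UNIV. A $ i $ j * f i) = (\<Sum>i\<in>UNIV. \<Sum>j\<in>UNIV. A $ i $ j * f j)"
proof -
  have "(\<Sum>i\<in>UNIV. \<Sum>j\<in>UNIV. A $ i $ j * f i) = (\<Sum>i\<in>UNIV. (\<Sum>j\<in>UNIV. A $ j $ i) * f i)"
    using assms by (simp add: weight_balanced_def sum_distrib_right[symmetric])
  also have "\<dots> = (\<Sum>j\<in>UNIV. \<Sum>i\<in>UNIV. A $ i $ j * f j)"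
    by (simp add: sum_distrib_right)
  also have "\<dots> = (\<Sum>i\<in>UNIV. \<Sum>j\<in>UNIV. A $ i $ j * f j)" by (rule sum.swap)
  finally show ?thesis .
qed

lemma laplacian_sum_zero:
  assumes "weight_balanced A"
  shows "(\<Sum>i\<in>UNIV. \<Sum>j\<in>UNIV. laplacian A $ i $ j * f j) = 0"
  using weight_balanced_sum_swap[OF assms, of f]
  by (simp add: laplacian_sum_mult right_diff_distrib sum_subtractf)

text \<open>
  The quadratic form sees only the symmetric part of the Laplacian.  For a balanced digraph that part
  is again a Laplacian, whose quadratic form is this sum of squares over the edges.
\<close>

lemma laplacian_quadratic_form:
  fixes A :: "real ^ 'n ^ 'n"
  assumes "weight_balanced A"
  shows "(\<Sum>i\<in>UNIV. f i * (\<Sum>j\<in>UNIV. laplacian A $ i $ j * f j))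
    = (\<Sum>i\<in>UNIV. \<Sum>j\<in>UNIV. A $ i $ j * (f i - f j)\<^sup>2) / 2"
proof -
  have "(\<Sum>i\<in>UNIV. \<Sum>j\<in>UNIV. A $ i $ j * (f i - f j)\<^sup>2)
    = (\<Sum>i\<in>UNIV. \<Sum>j\<in>UNIV. 2 * (f i * (A $ i $ j * (f i - f j)))
        - (A $ i $ j * (f i)\<^sup>2 - A $ i $ j * (f j)\<^sup>2))"
    by (intro sum.cong refl) (simp add: power2_eq_square algebra_simps)
  also have "\<dots> = 2 * (\<Sum>i\<in>UNIV. f i * (\<Sum>j\<in>UNIV. A $ i $ j * (f i - f j)))"
    using weight_balanced_sum_swap[OF assms, of "\<lambda>i. (f i)\<^sup>2"]
    by (simp only: sum_subtractf sum_distrib_left)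
  finally show ?thesis by (simp add: laplacian_sum_mult)
qed

lemma strongly_connected_invariant_const:
  fixes f :: "'n \<Rightarrow> 'a"
  assumes conn: "strongly_connected (digraph_of E)"
    and edge: "\<And>i j. (i, j) \<in> E \<Longrightarrow> f i = f j"
  shows "f i = f j"
proof -
  have "i \<rightarrow>\<^sup>*\<^bsub>digraph_of E\<^esub> j"
    using conn by (auto simp: digraph_of_def elim!: strongly_connectedE)
  then have "(i, j) \<in> rtrancl_on UNIV E"
    by (simp add: reachable_def digraph_of_def)
  then show ?thesis
    by induction (use edge in auto)
qed

text \<open>
  The quadratic form vanishes only where all edge differences do, which by strong connectivity means on
  constant vectors; the only zero-sum one is zero.  Its minimum over the compact set of zero-sum unit
  vectors is therefore positive, and homogeneity extends the bound to all zero-sum vectors.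
\<close>

lemma laplacian_spectral_gap:
  fixes A :: "real ^ 'n ^ 'n"
  assumes wd: "weighted_digraph E A" and conn: "strongly_connected (digraph_of E)"
    and bal: "weight_balanced A"
  obtains \<mu> where "\<mu> > 0"
    and "\<And>f. (\<Sum>i\<in>UNIV. f i) = 0 \<Longrightarrow>
      \<mu> * (\<Sum>i\<in>UNIV. (f i)\<^sup>2) \<le> (\<Sum>i\<in>UNIV. f i * (\<Sum>j\<in>UNIV. laplacian A $ i $ j * f j))"
proof -
  define Q where "Q f = (\<Sum>i\<in>UNIV. f i * (\<Sum>j\<in>UNIV. laplacian A $ i $ j * f j))" for f
  define S where "S = sphere 0 1 \<inter> {y :: real ^ 'n. (\<Sum>i\<in>UNIV. y $ i) = 0}"
  have A_nonneg: "A $ i $ j \<ge> 0" for i j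
    using wd by (cases "(i, j) \<in> E") (auto simp: weighted_digraph_def less_imp_le)
  have pos: "Q (($) y) > 0" if "y \<in> S" for y
  proof -
    have "Q (($) y) = (\<Sum>i\<in>UNIV. \<Sum>j\<in>UNIV. A $ i $ j * (y $ i - y $ j)\<^sup>2) / 2"
      unfolding Q_def by (rule laplacian_quadratic_form[OF bal])
    moreover have "\<dots> \<noteq> 0"
    proof
      assume "(\<Sum>i\<in>UNIV. \<Sum>j\<in>UNIV. A $ i $ j * (y $ i - y $ j)\<^sup>2) / 2 = 0"
      then have zero: "A $ i $ j * (y $ i - y $ j)\<^sup>2 = 0" for i j
        using A_nonneg by (simp add: sum_nonneg_eq_0_iff sum_nonneg)
      have edge: "y $ i = y $ j" if "(i, j) \<in> E" for i j
        using zero[of i j] wd that by (force simp: weighted_digraph_def)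
      have const: "y $ i = y $ j" for i j
        using strongly_connected_invariant_const[OF conn, of "($) y"] edge by blast
      have "y $ i = 0" for i
      proof -
        have "0 = (\<Sum>j\<in>UNIV. y $ j)" using \<open>y \<in> S\<close> by (simp add: S_def)
        also have "\<dots> = (\<Sum>j\<in>(UNIV :: 'n set). y $ i)" by (intro sum.cong refl const)
        finally show ?thesis by simp
      qed
      then have "y = 0" by (simp add: vec_eq_iff)
      then show False using \<open>y \<in> S\<close> by (simp add: S_def)
    qed
    moreover have "(\<Sum>i\<in>UNIV. \<Sum>j\<in>UNIV. A $ i $ j * (y $ i - y $ j)\<^sup>2) / 2 \<ge> 0"
      using A_nonneg by (simp add: sum_nonneg)
    ultimately show ?thesis by linarith
  qed
  have "\<exists>\<mu>>0. \<forall>y\<in>S. \<mu> \<le> Q (($) y)"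
  proof (cases "S = {}")
    \<comment> \<open>A single agent: no unit vector has sum zero.\<close>
    case True
    then show ?thesis by (intro exI[of _ 1]) auto
  next
    case False
    have "closed {y :: real ^ 'n. (\<Sum>i\<in>UNIV. y $ i) = 0}"
      by (intro closed_Collect_eq continuous_intros)
    then have "compact S" unfolding S_def by (intro compact_Int_closed) auto
    moreover have "continuous_on S (\<lambda>y. Q (($) y))"
      unfolding Q_def by (intro continuous_intros)
    ultimately obtain m where "m \<in> S" "\<forall>y\<in>S. Q (($) m) \<le> Q (($) y)"
      using continuous_attains_inf[of S] False by blast
    then show ?thesis using pos by blast
  qed
  then obtain \<mu> where "\<mu> > 0" and \<mu>: "\<And>y. y \<in> S \<Longrightarrow> \<mu> \<le> Q (($) y)" by blast
  have "\<mu> * (\<Sum>i\<in>UNIV. (f i)\<^sup>2) \<le> Q f" if sum0: "(\<Sum>i\<in>UNIV. f i) = 0" for f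
  proof (cases "\<forall>i. f i = 0")
    case True
    then show ?thesis by (simp add: Q_def)
  next
    case False
    define r where "r = norm (\<chi> i. f i)"
    have r2: "r\<^sup>2 = (\<Sum>i\<in>UNIV. (f i)\<^sup>2)"
      by (simp add: r_def norm_vec_def L2_set_def sum_nonneg)
    have "r > 0" using False by (auto simp: r_def vec_eq_iff)
    define y where "y = (1 / r) *\<^sub>R (\<chi> i. f i)"
    have "y \<in> S"
      using \<open>r > 0\<close> sum0 by (simp add: S_def y_def r_def sum_divide_distrib[symmetric])
    have "f = (\<lambda>i. r * y $ i)" using \<open>r > 0\<close> by (simp add: y_def)
    then have "Q f = r\<^sup>2 * Q (($) y)"
      by (simp add: Q_def sum_distrib_left power2_eq_square mult_ac)
    then show ?thesis
      using \<mu>[OF \<open>y \<in> S\<close>] mult_left_mono[of \<mu> "Q (($) y)" "r\<^sup>2"]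
      by (simp add: r2[symmetric] mult_ac)
  qed
  then show thesis using that \<open>\<mu> > 0\<close> by (auto simp: Q_def)
qed

section \<open>Consensus under vanishing perturbations\<close>

lemma laplacian_flow_tendsto_zero:
  fixes A :: "real ^ 'n ^ 'n"
  assumes graph: "weighted_digraph E A" "strongly_connected (digraph_of E)" "weight_balanced A"
    and "\<beta> > 0"
    and deriv: "\<And>i. has_time_derivative (y i)
      (\<lambda>t. - \<beta> * (\<Sum>j\<in>UNIV. laplacian A $ i $ j * y j t) + g i t)"
    and sum0: "\<And>t. (\<Sum>i\<in>UNIV. y i t) = 0"
    and lim: "\<And>i. (g i \<longlongrightarrow> 0) at_top"
  shows "(y i \<longlongrightarrow> 0) at_top"
proof -
  obtain \<mu> where "\<mu> > 0" and gap: "\<And>f. (\<Sum>i\<in>UNIV. f i) = 0 \<Longrightarrow>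
      \<mu> * (\<Sum>i\<in>UNIV. (f i)\<^sup>2) \<le> (\<Sum>i\<in>UNIV. f i * (\<Sum>j\<in>UNIV. laplacian A $ i $ j * f j))"
    using laplacian_spectral_gap[OF graph] by blast
  show ?thesis
  proof (rule dissipative_tendsto_zero[OF deriv _ _ lim, where c = "\<beta> * \<mu>"])
    show "\<beta> * \<mu> > 0" using \<open>\<beta> > 0\<close> \<open>\<mu> > 0\<close> by simp
    fix t :: real
    have "(\<Sum>i\<in>UNIV. y i t * (- \<beta> * (\<Sum>j\<in>UNIV. laplacian A $ i $ j * y j t) + g i t))
      = - \<beta> * (\<Sum>i\<in>UNIV. y i t * (\<Sum>j\<in>UNIV. laplacian A $ i $ j * y j t))
        + (\<Sum>i\<in>UNIV. y i t * g i t)"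
      by (simp only: distrib_left sum.distrib sum_distrib_left mult.left_commute)
    also have "\<dots> \<le> - \<beta> * (\<mu> * (\<Sum>i\<in>UNIV. (y i t)\<^sup>2)) + (\<Sum>i\<in>UNIV. y i t * g i t)"
      using gap[OF sum0, of t] \<open>\<beta> > 0\<close> by simp
    finally show "(\<Sum>i\<in>UNIV. y i t * (- \<beta> * (\<Sum>j\<in>UNIV. laplacian A $ i $ j * y j t) + g i t))
      \<le> - (\<beta> * \<mu>) * (\<Sum>i\<in>UNIV. (y i t)\<^sup>2) + (\<Sum>i\<in>UNIV. y i t * g i t)"
      by (simp add: mult_ac)
  qed
qed

definition disagreement :: "('n::finite \<Rightarrow> real) \<Rightarrow> 'n \<Rightarrow> real" where
  "disagreement f i = f i - 1 / real CARD('n) * (\<Sum>j\<in>UNIV. f j)"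

lemma sum_disagreement: "(\<Sum>i\<in>UNIV. disagreement f i) = 0"
  by (simp add: disagreement_def sum_subtractf)

lemma disagreement_add: "disagreement (\<lambda>i. f i + g i) i = disagreement f i + disagreement g i"
  by (simp add: disagreement_def sum.distrib algebra_simps)

lemma disagreement_diff: "disagreement (\<lambda>i. f i - g i) i = disagreement f i - disagreement g i"
  by (simp add: disagreement_def sum_subtractf algebra_simps)

lemma disagreement_mult: "disagreement (\<lambda>i. c * f i) i = c * disagreement f i"
  by (simp add: disagreement_def sum_distrib_left[symmetric] right_diff_distrib)

lemma laplacian_disagreement:
  "(\<Sum>j\<in>UNIV. laplacian A $ i $ j * disagreement f j) = (\<Sum>j\<in>UNIV. laplacian A $ i $ j * f j)"
  by (simp add: laplacian_sum_mult disagreement_def)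

lemma disagreement_laplacian:
  assumes "weight_balanced A"
  shows "disagreement (\<lambda>i. \<Sum>j\<in>UNIV. laplacian A $ i $ j * f j) i
    = (\<Sum>j\<in>UNIV. laplacian A $ i $ j * f j)"
  by (simp add: disagreement_def laplacian_sum_zero[OF assms])

lemma has_time_derivative_disagreement:
  assumes "\<And>i. has_time_derivative (f i) (f' i)"
  shows "has_time_derivative (\<lambda>t. disagreement (\<lambda>i. f i t) i) (\<lambda>t. disagreement (\<lambda>i. f' i t) i)"
  using assms unfolding has_time_derivative_def disagreement_def
  by (auto intro!: derivative_eq_intros)

lemma disagreement_tendsto_zero:
  fixes f :: "'n::finite \<Rightarrow> real \<Rightarrow> real"
  assumes "\<And>i. converges_to (f i) l"
  shows "((\<lambda>t. disagreement (\<lambda>i. f i t) i) \<longlongrightarrow> 0) at_top"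
proof -
  have "disagreement (\<lambda>i. f i t) i = disagreement (\<lambda>i. f i t - l t) i" for t
    by (simp add: disagreement_def sum_subtractf algebra_simps)
  moreover have "((\<lambda>t. disagreement (\<lambda>i. f i t - l t) i) \<longlongrightarrow> 0) at_top"
  proof -
    have lim: "((\<lambda>t. f j t - l t) \<longlongrightarrow> 0) at_top" for j
      using assms by (simp add: converges_to_def)
    have "((\<lambda>t. \<Sum>j\<in>UNIV. f j t - l t) \<longlongrightarrow> 0) at_top"
      by (rule tendsto_null_sum) (rule lim)
    from tendsto_diff[OF lim[of i] tendsto_mult_right_zero[OF this, of "1 / real CARD('n)"]]
    show ?thesis
      by (simp add: disagreement_def)
  qed
  ultimately show ?thesis by simp
qed

text \<open>
  The common target \<open>l\<close> is invisible to the deviations from the average, so these satisfy the scalar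
  equation in \<open>scalar_decay\<close> with a vanishing right-hand side.
\<close>

lemma disagreement_decay:
  assumes "\<And>i. has_time_derivative (f i) (f' i)" "\<alpha> > 0"
    and "\<And>i. converges_to (\<lambda>t. f' i t + \<alpha> * f i t) l"
  shows "((\<lambda>t. disagreement (\<lambda>i. f i t) i) \<longlongrightarrow> 0) at_top"
proof (rule scalar_decay[OF has_time_derivative_disagreement[of f f', OF assms(1)] \<open>\<alpha> > 0\<close>])
  show "((\<lambda>t. disagreement (\<lambda>i. f' i t) i + \<alpha> * disagreement (\<lambda>i. f i t) i) \<longlongrightarrow> 0) at_top"
    using disagreement_tendsto_zero[of "\<lambda>i t. f' i t + \<alpha> * f i t" l i, OF assms(3)]
    by (simp only: disagreement_add disagreement_mult)
qed

section \<open>Dynamic average consensus\<close>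

theorem lemma4p3:
  fixes E :: "'n::finite rel"
    and A :: "real ^ 'n ^ 'n"
    and u u' x v :: "'n \<Rightarrow> real \<Rightarrow> real"
    and \<alpha> \<beta> :: real
  assumes "weighted_digraph E A"
    and "strongly_connected (digraph_of E)"
    and "weight_balanced A"
    and "\<alpha> > 0"
    and "\<And>i. has_time_derivative (u i) (u' i)"
    and "(\<exists>l. \<forall>i. converges_to (\<lambda>t. u' i t + \<alpha> * u i t) l) \<or>
         (\<exists>u'' l. (\<forall>i. has_time_derivative (u' i) (u'' i)) \<and>
                  (\<forall>i. converges_to (\<lambda>t. u'' i t + \<alpha> * u' i t) l))"
    and "\<beta> > 0"
    and "\<And>i. has_time_derivative (x i)
           (\<lambda>t. u' i t - \<alpha> * (x i t - u i t)
                - \<beta> * (\<Sum>j\<in>UNIV. laplacian A $ i $ j * x j t) - v i t)"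
    and "\<And>i. has_time_derivative (v i)
           (\<lambda>t. \<alpha> * \<beta> * (\<Sum>j\<in>UNIV. laplacian A $ i $ j * x j t))"
    and "(\<Sum>i\<in>UNIV. v i 0) = 0"
  shows "\<And>i. converges_to (x i) (\<lambda>t. 1 / real CARD('n) * (\<Sum>j\<in>UNIV. u j t))"
proof -
  \<comment> \<open>The combination in which inputs and Laplacian terms cancel upon differentiation.\<close>
  define r where "r i t = v i t + \<alpha> * (x i t - u i t)" for i t
  define Lx where "Lx i t = (\<Sum>j\<in>UNIV. laplacian A $ i $ j * x j t)" for i t
  have x_deriv: "has_time_derivative (x i) (\<lambda>t. u' i t - \<beta> * Lx i t - r i t)" for i
    using assms(8)[of i] by (simp add: r_def Lx_def algebra_simps)
  have r_deriv: "has_time_derivative (r i) (\<lambda>t. - \<alpha> * r i t)" for i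
    using x_deriv[of i] assms(5)[of i] assms(9)[of i]
    unfolding has_time_derivative_def r_def Lx_def
    by (auto intro!: derivative_eq_intros simp: algebra_simps)
  have r_lim: "(r i \<longlongrightarrow> 0) at_top" for i
    by (rule scalar_decay[OF r_deriv \<open>\<alpha> > 0\<close>]) simp

  have v_sum: "(\<Sum>i\<in>UNIV. v i t) = 0" if "t \<ge> 0" for t
  proof -
    have "((\<lambda>t. \<Sum>i\<in>UNIV. v i t) has_real_derivative 0) (at s within {0..})" if "s \<in> {0..}" for s
      using assms(9) that laplacian_sum_zero[OF assms(3), of "\<lambda>j. x j s"]
      unfolding has_time_derivative_def
      by (auto intro!: derivative_eq_intros simp: sum_distrib_left[symmetric])
    then obtain c where "\<forall>s\<in>{0..}. (\<Sum>i\<in>UNIV. v i s) = c"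
      using has_field_derivative_zero_constant[of "{0..}" "\<lambda>t. \<Sum>i\<in>UNIV. v i t"] by auto
    then show ?thesis using assms(10) that by force
  qed
  have mean_lim: "((\<lambda>t. 1 / real CARD('n) * (\<Sum>j\<in>UNIV. x j t - u j t)) \<longlongrightarrow> 0) at_top"
  proof (rule Lim_transform_eventually)
    show "((\<lambda>t. 1 / real CARD('n) * ((\<Sum>j\<in>UNIV. r j t) / \<alpha>)) \<longlongrightarrow> 0) at_top"
      using \<open>\<alpha> > 0\<close> by (auto intro!: tendsto_eq_intros r_lim)
    have "(\<Sum>j\<in>UNIV. r j t) / \<alpha> = (\<Sum>j\<in>UNIV. x j t - u j t)" if "t \<ge> 0" for t
      using v_sum[OF that] \<open>\<alpha> > 0\<close>
      by (simp add: r_def sum.distrib sum_distrib_left[symmetric])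
    then show "\<forall>\<^sub>F t in at_top. 1 / real CARD('n) * ((\<Sum>j\<in>UNIV. r j t) / \<alpha>)
        = 1 / real CARD('n) * (\<Sum>j\<in>UNIV. x j t - u j t)"
      by (intro eventually_mono[OF eventually_ge_at_top[of 0]]) simp
  qed

  have dis_r: "((\<lambda>t. disagreement (\<lambda>i. r i t) i) \<longlongrightarrow> 0) at_top" for i
    using disagreement_tendsto_zero[of r "\<lambda>_. 0"] r_lim by (simp add: converges_to_def)
  have dis_Lx: "disagreement (\<lambda>i. Lx i t) i = Lx i t" for i t
    unfolding Lx_def by (rule disagreement_laplacian[OF assms(3)])
  \<comment> \<open>Under the first hypothesis \<open>disagreement_decay\<close> applies to \<open>u\<close>, and the deviations of \<open>u'\<close>
    then vanish as the limit of a difference; under the second it applies to \<open>u'\<close> directly.\<close>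
  have dis_u': "((\<lambda>t. disagreement (\<lambda>i. u' i t) i) \<longlongrightarrow> 0) at_top" for i
    using assms(6)
  proof (elim disjE exE conjE)
    fix l assume l: "\<forall>i. converges_to (\<lambda>t. u' i t + \<alpha> * u i t) l"
    have "((\<lambda>t. disagreement (\<lambda>i. u i t) i) \<longlongrightarrow> 0) at_top"
      by (rule disagreement_decay[of u u' \<alpha> l]) (use assms(4,5) l in auto)
    moreover have "((\<lambda>t. disagreement (\<lambda>i. u' i t + \<alpha> * u i t) i) \<longlongrightarrow> 0) at_top"
      by (rule disagreement_tendsto_zero[of _ l]) (use l in auto)
    ultimately have "((\<lambda>t. disagreement (\<lambda>i. u' i t + \<alpha> * u i t) i
        - \<alpha> * disagreement (\<lambda>i. u i t) i) \<longlongrightarrow> 0) at_top"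
      by (auto intro!: tendsto_eq_intros)
    then show ?thesis by (simp add: disagreement_add disagreement_mult)
  next
    fix u'' l
    assume "\<forall>i. has_time_derivative (u' i) (u'' i)"
      "\<forall>i. converges_to (\<lambda>t. u'' i t + \<alpha> * u' i t) l"
    then show ?thesis
      by (intro disagreement_decay[of u' u'' \<alpha> l]) (use assms(4) in auto)
  qed

  define y where "y i = (\<lambda>t. disagreement (\<lambda>i. x i t) i)" for i
  define g where "g i t = disagreement (\<lambda>i. u' i t) i - disagreement (\<lambda>i. r i t) i" for i t
  have y_lim: "(y i \<longlongrightarrow> 0) at_top" for i
  proof (rule laplacian_flow_tendsto_zero[OF assms(1-3) \<open>\<beta> > 0\<close>])
    have "(\<Sum>j\<in>UNIV. laplacian A $ i $ j * y j t) = Lx i t" for i t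
      by (simp add: y_def Lx_def laplacian_disagreement)
    then have "disagreement (\<lambda>i. u' i t - \<beta> * Lx i t - r i t) i
      = - \<beta> * (\<Sum>j\<in>UNIV. laplacian A $ i $ j * y j t) + g i t" for i t
      by (simp add: disagreement_diff disagreement_mult dis_Lx g_def)
    then show "has_time_derivative (y i)
      (\<lambda>t. - \<beta> * (\<Sum>j\<in>UNIV. laplacian A $ i $ j * y j t) + g i t)" for i
      using has_time_derivative_disagreement[of x _ i, OF x_deriv]
      by (simp only: y_def)
    show "(\<Sum>i\<in>UNIV. y i t) = 0" for t unfolding y_def by (rule sum_disagreement)
    show "(g i \<longlongrightarrow> 0) at_top" for i
      unfolding g_def by (auto intro!: tendsto_eq_intros dis_u' dis_r)
  qed

  fix i
  have "x i t - 1 / real CARD('n) * (\<Sum>j\<in>UNIV. u j t)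
    = y i t + 1 / real CARD('n) * (\<Sum>j\<in>UNIV. x j t - u j t)" for t
    by (simp add: y_def disagreement_def sum_subtractf diff_divide_distrib)
  then show "converges_to (x i) (\<lambda>t. 1 / real CARD('n) * (\<Sum>j\<in>UNIV. u j t))"
    unfolding converges_to_def using tendsto_add[OF y_lim mean_lim] by simp
qed

end
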